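(* Let $\delta\in[0,1]$, let $0\le t_{n-1}<t_n<t_{n+1}$, let $f:[0,\infty)\times V\to V$ with $V=\mathbb{R}^d$ or $V=\mathbb{C}^d$, and let $y_{n-1},y_n\in V$. Then the refactorized algorithm (pre-process, backward Euler solve, post-process; see context) is equivalent to one step of the DLN method (see context) with the same data. That is, a vector $y_{n+1}\in V$ satisfies the DLN equation $$\frac{\alpha_{2}y_{n+1}+\alpha_{1}y_{n}+\alpha_{0}y_{n-1}}{\widehat{k}_{n}}=f\Big(\beta_{2}^{(n)}t_{n+1}+\beta_{1}^{(n)}t_{n}+\beta_{0}^{(n)}t_{n-1},\ \beta_{2}^{(n)}y_{n+1}+\beta_{1}^{(n)}y_{n}+\beta_{0}^{(n)}y_{n-1}\Big)$$ if and only if there is $y^{\rm new}\in V$ satisfying the backward Euler equation $$\frac{y^{\rm new}-y^{\rm old}}{(\Delta t)_n^{\rm BE}}=f(t^{\rm new},y^{\rm new})$$ and such that $$y_{n+1}=c_2^{(n)}y^{\rm new}+c_1^{(n)}y_n+c_0^{(n)}y_{n-1}.$$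
   Context: Time steps: $k_n=t_{n+1}-t_n$, $k_{n-1}=t_n-t_{n-1}$, and step variability $\varepsilon_n=(k_n-k_{n-1})/(k_n+k_{n-1})$. DLN coefficients for the parameter $\delta\in[0,1]$: $$\alpha_2=\tfrac12(\delta+1),\qquad \alpha_1=-\delta,\qquad \alpha_0=\tfrac12(\delta-1),$$ $$\beta_2^{(n)}=\tfrac14\Big(1+\tfrac{1-\delta^2}{(1+\varepsilon_n\delta)^2}+\varepsilon_n^2\tfrac{\delta(1-\delta^2)}{(1+\varepsilon_n\delta)^2}+\delta\Big),\qquad \beta_1^{(n)}=\tfrac12\Big(1-\tfrac{1-\delta^2}{(1+\varepsilon_n\delta)^2}\Big),$$ $$\beta_0^{(n)}=\tfrac14\Big(1+\tfrac{1-\delta^2}{(1+\varepsilon_n\delta)^2}-\varepsilon_n^2\tfrac{\delta(1-\delta^2)}{(1+\varepsilon_n\delta)^2}-\delta\Big).$$ Average step: $\widehat{k}_n=\alpha_2k_n-\alpha_0k_{n-1}$. The DLN (Dahlquist–Liniger–Nevanlinna) method for $y'=f(t,y)$ is the one-leg two-step method determining $y_{n+1}$ from $y_n,y_{n-1}$ by the DLN equation displayed in the claim. Refactorized algorithm, with input $y_n,y_{n-1},t_{n-1},t_n,t_{n+1}$ and output $y_{n+1}$. Define the refactorization coefficients $$a_1^{(n)}=\beta_1^{(n)}-\frac{\alpha_1\beta_2^{(n)}}{\alpha_2},\qquad a_0^{(n)}=1-a_1^{(n)},\qquad b^{(n)}=\frac{\beta_2^{(n)}}{\alpha_2},$$ $$c_2^{(n)}=\frac1{\beta_2^{(n)}},\qquad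 c_1^{(n)}=-\frac{\beta_1^{(n)}}{\beta_2^{(n)}},\qquad c_0^{(n)}=-\frac{\beta_0^{(n)}}{\beta_2^{(n)}}.$$ Pre-process: set $(\Delta t)_n^{\rm BE}=b^{(n)}\widehat{k}_n$, $t^{\rm new}=\beta_2^{(n)}t_{n+1}+\beta_1^{(n)}t_n+\beta_0^{(n)}t_{n-1}$, and $y^{\rm old}=a_1^{(n)}y_n+a_0^{(n)}y_{n-1}$. Backward Euler: solve $\dfrac{y^{\rm new}-y^{\rm old}}{(\Delta t)_n^{\rm BE}}=f(t^{\rm new},y^{\rm new})$ for $y^{\rm new}$. Post-process: set $y_{n+1}=c_2^{(n)}y^{\rm new}+c_1^{(n)}y_n+c_0^{(n)}y_{n-1}$. *)

theory Defs
  imports "HOL-Analysis.Analysis"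
begin

text \<open>
  Throughout, the suffixes 0, 1, 2 stand for the time levels n-1, n, n+1: the times are
  \<open>t0 < t1 < t2\<close>, with states \<open>y0\<close>, \<open>y1\<close>, \<open>y2\<close>.
\<close>

definition step_variability :: "real \<Rightarrow> real \<Rightarrow> real \<Rightarrow> real" where
  "step_variability t0 t1 t2 = ((t2 - t1) - (t1 - t0)) / ((t2 - t1) + (t1 - t0))"

definition alpha2 :: "real \<Rightarrow> real" where
  "alpha2 \<delta> = 1/2 * (\<delta> + 1)"

definition alpha1 :: "real \<Rightarrow> real" where
  "alpha1 \<delta> = - \<delta>"

definition alpha0 :: "real \<Rightarrow> real" where
  "alpha0 \<delta> = 1/2 * (\<delta> - 1)"

definition beta2 :: "real \<Rightarrow> real \<Rightarrow> real" where
  "beta2 \<delta> \<epsilon> = 1/4 * (1 + (1 - \<delta>^2) / (1 + \<epsilon> * \<delta>)^2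
                      + \<epsilon>^2 * (\<delta> * (1 - \<delta>^2) / (1 + \<epsilon> * \<delta>)^2) + \<delta>)"

definition beta1 :: "real \<Rightarrow> real \<Rightarrow> real" where
  "beta1 \<delta> \<epsilon> = 1/2 * (1 - (1 - \<delta>^2) / (1 + \<epsilon> * \<delta>)^2)"

definition beta0 :: "real \<Rightarrow> real \<Rightarrow> real" where
  "beta0 \<delta> \<epsilon> = 1/4 * (1 + (1 - \<delta>^2) / (1 + \<epsilon> * \<delta>)^2
                      - \<epsilon>^2 * (\<delta> * (1 - \<delta>^2) / (1 + \<epsilon> * \<delta>)^2) - \<delta>)"

definition average_step :: "real \<Rightarrow> real \<Rightarrow> real \<Rightarrow> real \<Rightarrow> real" where
  "average_step \<delta> t0 t1 t2 = alpha2 \<delta> * (t2 - t1) - alpha0 \<delta> * (t1 - t0)"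

text \<open>
  The right-hand side \<open>f\<close> is a total function of the time, although only its values at
  nonnegative times are meant. This is harmless: it is evaluated only at the time
  \<open>dln_time\<close>, which is nonnegative by \<open>dln_time_gt\<close> below.
\<close>

definition dln_time :: "real \<Rightarrow> real \<Rightarrow> real \<Rightarrow> real \<Rightarrow> real" where
  "dln_time \<delta> t0 t1 t2 =
     (let \<epsilon> = step_variability t0 t1 t2
      in beta2 \<delta> \<epsilon> * t2 + beta1 \<delta> \<epsilon> * t1 + beta0 \<delta> \<epsilon> * t0)"

definition dln_equation ::
    "real \<Rightarrow> (real \<Rightarrow> 'v \<Rightarrow> 'v) \<Rightarrow> real \<Rightarrow> real \<Rightarrow> real \<Rightarrow> 'v \<Rightarrow> 'v \<Rightarrow> 'v::real_vector \<Rightarrow> bool" where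
  "dln_equation \<delta> f t0 t1 t2 y0 y1 y2 \<longleftrightarrow>
     (let \<epsilon> = step_variability t0 t1 t2
      in (alpha2 \<delta> *\<^sub>R y2 + alpha1 \<delta> *\<^sub>R y1 + alpha0 \<delta> *\<^sub>R y0) /\<^sub>R average_step \<delta> t0 t1 t2
         = f (dln_time \<delta> t0 t1 t2)
             (beta2 \<delta> \<epsilon> *\<^sub>R y2 + beta1 \<delta> \<epsilon> *\<^sub>R y1 + beta0 \<delta> \<epsilon> *\<^sub>R y0))"

definition refac_a1 :: "real \<Rightarrow> real \<Rightarrow> real" where
  "refac_a1 \<delta> \<epsilon> = beta1 \<delta> \<epsilon> - alpha1 \<delta> * beta2 \<delta> \<epsilon> / alpha2 \<delta>"

definition refac_a0 :: "real \<Rightarrow> real \<Rightarrow> real" where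
  "refac_a0 \<delta> \<epsilon> = 1 - refac_a1 \<delta> \<epsilon>"

definition refac_b :: "real \<Rightarrow> real \<Rightarrow> real" where
  "refac_b \<delta> \<epsilon> = beta2 \<delta> \<epsilon> / alpha2 \<delta>"

definition refac_c2 :: "real \<Rightarrow> real \<Rightarrow> real" where
  "refac_c2 \<delta> \<epsilon> = 1 / beta2 \<delta> \<epsilon>"

definition refac_c1 :: "real \<Rightarrow> real \<Rightarrow> real" where
  "refac_c1 \<delta> \<epsilon> = - (beta1 \<delta> \<epsilon> / beta2 \<delta> \<epsilon>)"

definition refac_c0 :: "real \<Rightarrow> real \<Rightarrow> real" where
  "refac_c0 \<delta> \<epsilon> = - (beta0 \<delta> \<epsilon> / beta2 \<delta> \<epsilon>)"

definition pre_step :: "real \<Rightarrow> real \<Rightarrow> real \<Rightarrow> real \<Rightarrow> real" where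
  "pre_step \<delta> t0 t1 t2 = refac_b \<delta> (step_variability t0 t1 t2) * average_step \<delta> t0 t1 t2"

definition pre_state ::
    "real \<Rightarrow> real \<Rightarrow> real \<Rightarrow> real \<Rightarrow> 'v \<Rightarrow> 'v \<Rightarrow> 'v::real_vector" where
  "pre_state \<delta> t0 t1 t2 y0 y1 =
     (let \<epsilon> = step_variability t0 t1 t2
      in refac_a1 \<delta> \<epsilon> *\<^sub>R y1 + refac_a0 \<delta> \<epsilon> *\<^sub>R y0)"

definition backward_euler ::
    "(real \<Rightarrow> 'v \<Rightarrow> 'v) \<Rightarrow> real \<Rightarrow> real \<Rightarrow> 'v \<Rightarrow> 'v::real_vector \<Rightarrow> bool" where
  "backward_euler f dt tnew yold ynew \<longleftrightarrow> (ynew - yold) /\<^sub>R dt = f tnew ynew"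

definition post_state ::
    "real \<Rightarrow> real \<Rightarrow> real \<Rightarrow> real \<Rightarrow> 'v \<Rightarrow> 'v \<Rightarrow> 'v \<Rightarrow> 'v::real_vector" where
  "post_state \<delta> t0 t1 t2 y0 y1 ynew =
     (let \<epsilon> = step_variability t0 t1 t2
      in refac_c2 \<delta> \<epsilon> *\<^sub>R ynew + refac_c1 \<delta> \<epsilon> *\<^sub>R y1 + refac_c0 \<delta> \<epsilon> *\<^sub>R y0)"

lemma dln_time_gt:
  assumes "0 \<le> \<delta>" "\<delta> \<le> 1" "t0 < t1" "t1 < t2"
  shows "t0 < dln_time \<delta> t0 t1 t2"
proof -
  define S where "S = t2 - t0"
  define \<epsilon> where "\<epsilon> = step_variability t0 t1 t2"
  have S: "S > 0" using assms by (simp add: S_def)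
  have \<epsilon>eq: "\<epsilon> = (t2 + t0 - 2 * t1) / S"
    by (simp add: \<epsilon>_def step_variability_def S_def algebra_simps)
  have e1: "-1 < \<epsilon>" and e2: "\<epsilon> < 1"
    using S assms by (simp_all add: \<epsilon>eq S_def field_simps)
  have t1: "t1 - t0 = S * (1 - \<epsilon>) / 2"
    using S by (simp add: \<epsilon>eq field_simps) (simp add: S_def algebra_simps)
  have "- 1 < \<epsilon> * \<delta>"
  proof (cases "\<epsilon> \<ge> 0")
    case True
    then have "0 \<le> \<epsilon> * \<delta>" using assms by simp
    then show ?thesis by linarith
  next
    case False
    then have "\<epsilon> * 1 \<le> \<epsilon> * \<delta>" using assms by (intro mult_left_mono_neg) auto
    then show ?thesis using e1 by linarith
  qed
  then have p: "1 + \<epsilon> * \<delta> > 0" by simp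
  define A where "A = (1 - \<delta>^2) / (1 + \<epsilon> * \<delta>)^2"
  have Ap: "A * (1 + \<epsilon> * \<delta>) = (1 - \<delta>^2) / (1 + \<epsilon> * \<delta>)"
    using p by (simp add: A_def power2_eq_square)
  have b: "beta2 \<delta> \<epsilon> = 1/4 * (1 + \<delta> + A * (1 + \<epsilon>^2 * \<delta>))" "beta1 \<delta> \<epsilon> = 1/2 * (1 - A)"
    "beta0 \<delta> \<epsilon> = 1 - beta1 \<delta> \<epsilon> - beta2 \<delta> \<epsilon>"
    by (simp_all add: beta2_def beta1_def beta0_def A_def add_divide_distrib diff_divide_distrib algebra_simps)
  have "dln_time \<delta> t0 t1 t2 - t0 = beta2 \<delta> \<epsilon> * S + beta1 \<delta> \<epsilon> * (t1 - t0)"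
    by (simp add: dln_time_def Let_def flip: \<epsilon>_def)
       (simp add: b(3) S_def algebra_simps)
  also have "\<dots> = S / 4 * (2 + \<delta> - \<epsilon> + \<epsilon> * (A * (1 + \<epsilon> * \<delta>)))"
    unfolding t1 b(1,2) by (simp add: field_simps power2_eq_square)
  also have "2 + \<delta> - \<epsilon> + \<epsilon> * (A * (1 + \<epsilon> * \<delta>))
      = (2 + \<delta> - \<epsilon> + \<epsilon> * \<delta> * (2 + \<delta> - \<epsilon>) + \<epsilon> * (1 - \<delta>^2)) / (1 + \<epsilon> * \<delta>)"
    unfolding Ap using p by (simp add: field_simps)
  also have "2 + \<delta> - \<epsilon> + \<epsilon> * \<delta> * (2 + \<delta> - \<epsilon>) + \<epsilon> * (1 - \<delta>^2)
      = 2 * (1 + \<epsilon> * \<delta>) + \<delta> * (1 - \<epsilon>^2)"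
    by (simp add: algebra_simps power2_eq_square)
  finally have *: "dln_time \<delta> t0 t1 t2 - t0
      = S / 4 * ((2 * (1 + \<epsilon> * \<delta>) + \<delta> * (1 - \<epsilon>^2)) / (1 + \<epsilon> * \<delta>))" .
  have "\<epsilon>^2 \<le> 1" using e1 e2 by (simp add: abs_square_le_1)
  then have nn: "0 \<le> \<delta> * (1 - \<epsilon>^2)" using assms by simp
  have "0 < 2 * (1 + \<epsilon> * \<delta>) + \<delta> * (1 - \<epsilon>^2)" by (rule add_pos_nonneg[OF mult_pos_pos[OF zero_less_numeral p] nn])
  then have "0 < dln_time \<delta> t0 t1 t2 - t0" unfolding * using S p by simp
  then show ?thesis by simp
qed

end

theory Submission
  imports Defs
begin

text \<open>
  The backward Euler unknown is the state \<open>\<beta>\<^sub>2 y\<^sub>2 + \<beta>\<^sub>1 y\<^sub>1 + \<beta>\<^sub>0 y\<^sub>0\<close> at which the one-leg method evaluates \<open>f\<close>: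
  since \<open>\<beta>\<^sub>2 > 0\<close>, the post-process is the inverse of this affine map in \<open>y\<^sub>2\<close>. As the \<open>\<beta>\<close> sum to one
  and the \<open>\<alpha>\<close> to zero, subtracting the pre-processed state leaves \<open>\<beta>\<^sub>2 / \<alpha>\<^sub>2\<close> times the difference
  \<open>\<alpha>\<^sub>2 y\<^sub>2 + \<alpha>\<^sub>1 y\<^sub>1 + \<alpha>\<^sub>0 y\<^sub>0\<close>, and the same factor occurs in the backward Euler step.
\<close>

lemma alpha2_pos: "0 \<le> \<delta> \<Longrightarrow> 0 < alpha2 \<delta>"
  by (simp add: alpha2_def)

lemma alpha_sum: "alpha2 \<delta> + alpha1 \<delta> + alpha0 \<delta> = 0"
  by (simp add: alpha2_def alpha1_def alpha0_def field_simps)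

lemma beta_sum: "beta2 \<delta> \<epsilon> + beta1 \<delta> \<epsilon> + beta0 \<delta> \<epsilon> = 1"
proof -
  \<comment> \<open>Here \<open>a\<close> and \<open>b\<close> stand for the two fractions, which
    makes the identity linear and spares clearing denominators.\<close>
  have "1/4 * (1 + a + b + \<delta>) + 1/2 * (1 - a) + 1/4 * (1 + a - b - \<delta>) = 1" for a b :: real
    by (simp add: field_simps)
  then show ?thesis
    unfolding beta2_def beta1_def beta0_def .
qed

text \<open>Both fractions are nonnegative for every real \<epsilon>, even at
  \<open>1 + \<epsilon> * \<delta> = 0\<close>, where division by zero gives 0; the summand 1 makes
  the sum positive.\<close>

lemma beta2_pos:
  assumes "0 \<le> \<delta>" "\<delta> \<le> 1"
  shows "0 < beta2 \<delta> \<epsilon>"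
proof -
  have "0 \<le> 1 - \<delta>\<^sup>2"
    using assms by (simp add: power_le_one)
  then have "0 \<le> (1 - \<delta>\<^sup>2) / (1 + \<epsilon> * \<delta>)\<^sup>2" "0 \<le> \<epsilon>\<^sup>2 * (\<delta> * (1 - \<delta>\<^sup>2) / (1 + \<epsilon> * \<delta>)\<^sup>2)"
    using assms by simp_all
  then show ?thesis
    unfolding beta2_def using assms by (intro mult_pos_pos add_pos_nonneg) auto
qed

lemma eq_post_state_iff:
  fixes t0 t1 t2 :: real
  assumes "0 \<le> \<delta>" "\<delta> \<le> 1"
  defines "\<epsilon> \<equiv> step_variability t0 t1 t2"
  shows "y2 = post_state \<delta> t0 t1 t2 y0 y1 ynew \<longleftrightarrow>
         ynew = beta2 \<delta> \<epsilon> *\<^sub>R y2 + beta1 \<delta> \<epsilon> *\<^sub>R y1 + beta0 \<delta> \<epsilon> *\<^sub>R y0"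
proof -
  have pos: "beta2 \<delta> \<epsilon> \<noteq> 0"
    using beta2_pos[OF assms(1,2), of \<epsilon>] by simp
  have "beta2 \<delta> \<epsilon> *\<^sub>R post_state \<delta> t0 t1 t2 y0 y1 ynew
      = ynew - beta1 \<delta> \<epsilon> *\<^sub>R y1 - beta0 \<delta> \<epsilon> *\<^sub>R y0"
    using pos by (simp add: post_state_def refac_c2_def refac_c1_def refac_c0_def
        Let_def scaleR_diff_right flip: \<epsilon>_def)
  moreover have "y2 = post_state \<delta> t0 t1 t2 y0 y1 ynew \<longleftrightarrow>
      beta2 \<delta> \<epsilon> *\<^sub>R y2 = beta2 \<delta> \<epsilon> *\<^sub>R post_state \<delta> t0 t1 t2 y0 y1 ynew"
    using pos by simp
  ultimately show ?thesis
    by (auto simp: algebra_simps)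
qed

lemma diff_pre_state:
  fixes t0 t1 t2 :: real
  assumes "0 \<le> \<delta>"
  defines "\<epsilon> \<equiv> step_variability t0 t1 t2"
  shows "beta2 \<delta> \<epsilon> *\<^sub>R y2 + beta1 \<delta> \<epsilon> *\<^sub>R y1 + beta0 \<delta> \<epsilon> *\<^sub>R y0 - pre_state \<delta> t0 t1 t2 y0 y1
         = refac_b \<delta> \<epsilon> *\<^sub>R (alpha2 \<delta> *\<^sub>R y2 + alpha1 \<delta> *\<^sub>R y1 + alpha0 \<delta> *\<^sub>R y0)"
proof -
  have pos: "alpha2 \<delta> \<noteq> 0"
    using alpha2_pos[OF assms(1)] by simp
  have coeff2: "refac_b \<delta> \<epsilon> * alpha2 \<delta> = beta2 \<delta> \<epsilon>"
    using pos by (simp add: refac_b_def)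
  have coeff1: "refac_b \<delta> \<epsilon> * alpha1 \<delta> = beta1 \<delta> \<epsilon> - refac_a1 \<delta> \<epsilon>"
    by (simp add: refac_b_def refac_a1_def)
  \<comment> \<open>The coefficient of \<open>y0\<close> follows from the other two: the \<alpha>
    sum to 0, while the \<beta> and the pair \<open>refac_a1\<close>, \<open>refac_a0\<close> each
    sum to 1.\<close>
  have "refac_b \<delta> \<epsilon> * alpha0 \<delta> = - (refac_b \<delta> \<epsilon> * alpha2 \<delta>) - refac_b \<delta> \<epsilon> * alpha1 \<delta>"
  proof -
    have "alpha0 \<delta> = - alpha2 \<delta> - alpha1 \<delta>"
      using alpha_sum[of \<delta>] by linarith
    then show ?thesis
      by (simp only: right_diff_distrib mult_minus_right)
  qed
  also have "\<dots> = beta0 \<delta> \<epsilon> - refac_a0 \<delta> \<epsilon>"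
    using beta_sum[of \<delta> \<epsilon>] unfolding coeff2 coeff1 refac_a0_def by linarith
  finally have coeff0: "refac_b \<delta> \<epsilon> * alpha0 \<delta> = beta0 \<delta> \<epsilon> - refac_a0 \<delta> \<epsilon>" .
  show ?thesis
    by (simp add: pre_state_def Let_def scaleR_add_right coeff2 coeff1 coeff0
        scaleR_diff_left flip: \<epsilon>_def)
qed

text \<open>All coefficients are real, so a general real vector space covers \<open>real^'d\<close>
  and \<open>complex^'d\<close> at once.\<close>

lemma dln_equation_iff_refactorized:
  fixes f :: "real \<Rightarrow> 'v::real_vector \<Rightarrow> 'v"
  assumes "0 \<le> \<delta>" "\<delta> \<le> 1"
  shows "dln_equation \<delta> f t0 t1 t2 y0 y1 y2 \<longleftrightarrow>
         (\<exists>ynew. backward_euler f (pre_step \<delta> t0 t1 t2) (dln_time \<delta> t0 t1 t2)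
                   (pre_state \<delta> t0 t1 t2 y0 y1) ynew \<and>
                 y2 = post_state \<delta> t0 t1 t2 y0 y1 ynew)"
proof -
  have "refac_b \<delta> (step_variability t0 t1 t2) \<noteq> 0"
    using alpha2_pos[OF assms(1)] beta2_pos[OF assms, of "step_variability t0 t1 t2"]
    by (simp add: refac_b_def)
  \<comment> \<open>If \<open>average_step\<close> is 0, both sides vanish because
    \<open>inverse 0 = 0\<close>.\<close>
  then have "(refac_b \<delta> (step_variability t0 t1 t2) *\<^sub>R v) /\<^sub>R pre_step \<delta> t0 t1 t2
      = v /\<^sub>R average_step \<delta> t0 t1 t2" for v :: 'v
    by (simp add: pre_step_def field_simps)
  \<comment> \<open>The post-process conjunct now fixes \<open>ynew\<close>, so the existential
    reduces to this one witness.\<close>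
  then show ?thesis
    unfolding eq_post_state_iff[OF assms] backward_euler_def dln_equation_def Let_def
    by (metis diff_pre_state[OF assms(1)])
qed

theorem theorem2p1:
  fixes \<delta> t0 t1 t2 :: real
  assumes "0 \<le> \<delta>" and "\<delta> \<le> 1"
    and "0 \<le> t0" and "t0 < t1" and "t1 < t2"
  shows "(\<forall>(f :: real \<Rightarrow> real^'d \<Rightarrow> real^'d) y0 y1 y2.
            dln_equation \<delta> f t0 t1 t2 y0 y1 y2 \<longleftrightarrow>
            (\<exists>ynew. backward_euler f (pre_step \<delta> t0 t1 t2) (dln_time \<delta> t0 t1 t2)
                      (pre_state \<delta> t0 t1 t2 y0 y1) ynew \<and>
                    y2 = post_state \<delta> t0 t1 t2 y0 y1 ynew))
       \<and> (\<forall>(f :: real \<Rightarrow> complex^'d \<Rightarrow> complex^'d) y0 y1 y2.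
            dln_equation \<delta> f t0 t1 t2 y0 y1 y2 \<longleftrightarrow>
            (\<exists>ynew. backward_euler f (pre_step \<delta> t0 t1 t2) (dln_time \<delta> t0 t1 t2)
                      (pre_state \<delta> t0 t1 t2 y0 y1) ynew \<and>
                    y2 = post_state \<delta> t0 t1 t2 y0 y1 ynew))"
  by (intro conjI allI dln_equation_iff_refactorized assms(1,2))

end
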